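(* Let $k\ge 2$. A complete system of representatives of $\mathbb{Z}^{2k}/\sim$ (i.e. a subset containing exactly one element of each $\sim$-class) is given by the disjoint union $$\{(x,\dots,x)\in\mathbb{Z}^{2k}\mid x\in\mathbb{Z}\}\sqcup D\sqcup\bigsqcup_{p=1}^{2k-2}E_p,$$ where $D$ and $E_p$ $(1\le p\le 2k-2)$ are the subsets of $\mathbb{Z}^{2k}$ defined by $$D=\Bigl\{(x,\,x+(2n-1)(y-x),\,\underbrace{y,\dots,y}_{2k-2})\in\mathbb{Z}^{2k}\Bigm| 0\le 2x<y,\ n\in\mathbb{Z}\Bigr\},$$ $$E_p=\Bigl\{(\underbrace{x,\dots,x}_{p},\,x+2n(y-x),\,\underbrace{y,\dots,y}_{2k-p-1})\in\mathbb{Z}^{2k}\Bigm| 0\le 2x<y,\ n\in\mathbb{Z}\Bigr\}.$$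
   Context: For $m\ge2$, $B_m$ is the $m$-braid group with standard generators $\sigma_1,\dots,\sigma_{m-1}$ (relations $\sigma_i\sigma_j=\sigma_j\sigma_i$ for $|i-j|\ge2$ and $\sigma_i\sigma_{i+1}\sigma_i=\sigma_{i+1}\sigma_i\sigma_{i+1}$). It acts on $\mathbb{Z}^m$ on the right by the Hurwitz action $(a_1,\dots,a_m)\cdot\sigma_i=(a_1,\dots,a_{i-1},a_{i+1},2a_{i+1}-a_i,a_{i+2},\dots,a_m)$. For $v,w\in\mathbb{Z}^m$, $v\sim w$ means that $v\cdot\beta=w$ for some $\beta\in B_m$. *)

theory Defs
  imports "HOL-Algebra.Group" "HOL-Library.Disjoint_Sets"
begin

section \<open>The braid group on \<open>m\<close> strands, by generators and relations\<close>

datatype braid_letter = Gen nat | GenInv nat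

fun letter_index :: "braid_letter \<Rightarrow> nat" where
  "letter_index (Gen i) = i"
| "letter_index (GenInv i) = i"

fun letter_inv :: "braid_letter \<Rightarrow> braid_letter" where
  "letter_inv (Gen i) = GenInv i"
| "letter_inv (GenInv i) = Gen i"

definition braid_words :: "nat \<Rightarrow> braid_letter list set" where
  "braid_words m = {w. \<forall>l \<in> set w. 1 \<le> letter_index l \<and> letter_index l < m}"

inductive braid_eq :: "nat \<Rightarrow> braid_letter list \<Rightarrow> braid_letter list \<Rightarrow> bool" for m :: nat where
  refl: "w \<in> braid_words m \<Longrightarrow> braid_eq m w w"
| sym: "braid_eq m u v \<Longrightarrow> braid_eq m v u"
| trans: "braid_eq m u v \<Longrightarrow> braid_eq m v w \<Longrightarrow> braid_eq m u w"
| append: "braid_eq m u u' \<Longrightarrow> braid_eq m v v' \<Longrightarrow> braid_eq m (u @ v) (u' @ v')"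
| cancel_right: "1 \<le> i \<Longrightarrow> i < m \<Longrightarrow> braid_eq m [Gen i, GenInv i] []"
| cancel_left: "1 \<le> i \<Longrightarrow> i < m \<Longrightarrow> braid_eq m [GenInv i, Gen i] []"
| far: "1 \<le> i \<Longrightarrow> i + 2 \<le> j \<Longrightarrow> j < m \<Longrightarrow> braid_eq m [Gen i, Gen j] [Gen j, Gen i]"
| braid: "1 \<le> i \<Longrightarrow> i + 1 < m \<Longrightarrow>
    braid_eq m [Gen i, Gen (i + 1), Gen i] [Gen (i + 1), Gen i, Gen (i + 1)]"

definition braid_rel :: "nat \<Rightarrow> (braid_letter list \<times> braid_letter list) set" where
  "braid_rel m = {(u, v). braid_eq m u v}"

definition braid_group :: "nat \<Rightarrow> braid_letter list set monoid" where
  "braid_group m =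
    \<lparr> carrier = braid_words m // braid_rel m,
      mult = (\<lambda>A B. \<Union>a\<in>A. \<Union>b\<in>B. braid_rel m `` {a @ b}),
      one = braid_rel m `` {[]} \<rparr>"

definition braid_gen :: "nat \<Rightarrow> nat \<Rightarrow> braid_letter list set" where
  "braid_gen m i = braid_rel m `` {[Gen i]}"

lemma braid_words_Nil [simp]: "[] \<in> braid_words m"
  by (simp add: braid_words_def)

lemma braid_words_append [simp]:
  "u @ v \<in> braid_words m \<longleftrightarrow> u \<in> braid_words m \<and> v \<in> braid_words m"
  by (auto simp: braid_words_def)

lemma braid_eq_words: "braid_eq m u v \<Longrightarrow> u \<in> braid_words m \<and> v \<in> braid_words m"
  by (induction rule: braid_eq.induct) (auto simp: braid_words_def)

lemma equiv_braid_rel: "equiv (braid_words m) (braid_rel m)"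
  by (rule equivI)
     (auto simp: braid_rel_def refl_on_def sym_def trans_def dest: braid_eq_words
        intro: braid_eq.intros)

lemma braid_class_eq: "braid_eq m u v \<Longrightarrow> braid_rel m `` {u} = braid_rel m `` {v}"
  by (rule equiv_class_eq[OF equiv_braid_rel]) (simp add: braid_rel_def)

lemma braid_mult_class:
  assumes "u \<in> braid_words m" "v \<in> braid_words m"
  shows "braid_rel m `` {u} \<otimes>\<^bsub>braid_group m\<^esub> braid_rel m `` {v} = braid_rel m `` {u @ v}"
proof -
  have "(\<lambda>a b. braid_rel m `` {a @ b}) respects2 braid_rel m"
  proof (rule congruent2I[OF equiv_braid_rel equiv_braid_rel])
    fix y z w assume "(y, z) \<in> braid_rel m" "w \<in> braid_words m"
    then have yz: "braid_eq m y z" and w: "braid_eq m w w"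
      by (simp_all add: braid_rel_def braid_eq.refl)
    show "braid_rel m `` {y @ w} = braid_rel m `` {z @ w}"
      by (intro braid_class_eq braid_eq.append yz w)
    show "braid_rel m `` {w @ y} = braid_rel m `` {w @ z}"
      by (intro braid_class_eq braid_eq.append yz w)
  qed
  from UN_equiv_class2[OF equiv_braid_rel equiv_braid_rel this assms]
  show ?thesis by (simp add: braid_group_def)
qed

lemma letter_inv_words: "w \<in> braid_words m \<Longrightarrow> rev (map letter_inv w) \<in> braid_words m"
proof -
  have "letter_index (letter_inv l) = letter_index l" for l by (cases l) auto
  then show "w \<in> braid_words m \<Longrightarrow> rev (map letter_inv w) \<in> braid_words m"
    by (auto simp: braid_words_def)
qed

lemma braid_eq_letter_inv:
  "[l] \<in> braid_words m \<Longrightarrow> braid_eq m [letter_inv l, l] []"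
  by (cases l) (auto simp: braid_words_def intro: braid_eq.intros)

lemma braid_eq_word_inv:
  "w \<in> braid_words m \<Longrightarrow> braid_eq m (rev (map letter_inv w) @ w) []"
proof (induction w)
  case Nil
  then show ?case by (simp add: braid_eq.refl)
next
  case (Cons l w)
  then have l: "[l] \<in> braid_words m" and w: "w \<in> braid_words m"
    by (auto simp: braid_words_def)
  have "braid_eq m (rev (map letter_inv w) @ ([letter_inv l, l] @ w))
          (rev (map letter_inv w) @ ([] @ w))"
    by (intro braid_eq.append braid_eq.refl letter_inv_words braid_eq_letter_inv l w)
  with Cons.IH[OF w] show ?case by (auto intro: braid_eq.trans)
qed

lemma group_braid_group: "group (braid_group m)"
proof (rule groupI)
  have carr: "carrier (braid_group m) = braid_words m // braid_rel m"
    and one: "\<one>\<^bsub>braid_group m\<^esub> = braid_rel m `` {[]}"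
    by (simp_all add: braid_group_def)
  show "\<one>\<^bsub>braid_group m\<^esub> \<in> carrier (braid_group m)"
    by (simp add: carr one quotientI)
  fix x assume "x \<in> carrier (braid_group m)"
  then obtain u where u: "u \<in> braid_words m" "x = braid_rel m `` {u}"
    by (auto simp: carr elim: quotientE)
  show "\<one>\<^bsub>braid_group m\<^esub> \<otimes>\<^bsub>braid_group m\<^esub> x = x"
    using u by (simp add: one braid_mult_class)
  have "braid_rel m `` {rev (map letter_inv u)} \<otimes>\<^bsub>braid_group m\<^esub> x = \<one>\<^bsub>braid_group m\<^esub>"
    using u by (simp add: one braid_mult_class letter_inv_words
        braid_class_eq[OF braid_eq_word_inv])
  then show "\<exists>y\<in>carrier (braid_group m). y \<otimes>\<^bsub>braid_group m\<^esub> x = \<one>\<^bsub>braid_group m\<^esub>"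
    using letter_inv_words[OF u(1)] by (auto simp: carr intro!: bexI quotientI)
  fix y assume "y \<in> carrier (braid_group m)"
  then obtain v where v: "v \<in> braid_words m" "y = braid_rel m `` {v}"
    by (auto simp: carr elim: quotientE)
  show "x \<otimes>\<^bsub>braid_group m\<^esub> y \<in> carrier (braid_group m)"
    using u v by (simp add: carr braid_mult_class quotientI)
  fix z assume "z \<in> carrier (braid_group m)"
  then obtain w where w: "w \<in> braid_words m" "z = braid_rel m `` {w}"
    by (auto simp: carr elim: quotientE)
  show "x \<otimes>\<^bsub>braid_group m\<^esub> y \<otimes>\<^bsub>braid_group m\<^esub> z
      = x \<otimes>\<^bsub>braid_group m\<^esub> (y \<otimes>\<^bsub>braid_group m\<^esub> z)"
    using u v w by (simp add: braid_mult_class)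
qed

section \<open>The Hurwitz action\<close>

definition int_vecs :: "nat \<Rightarrow> int list set" where
  "int_vecs m = {v. length v = m}"

text \<open>
  The entry $a_j$ of a vector \<open>v\<close> is \<open>v ! (j - 1)\<close>, since list positions start at 0.
  The clause for \<open>GenInv\<close> is the inverse of the map given by \<open>Gen\<close>.
\<close>

fun letter_act :: "braid_letter \<Rightarrow> int list \<Rightarrow> int list" where
  "letter_act (Gen i) v = v[i - 1 := v ! i, i := 2 * v ! i - v ! (i - 1)]"
| "letter_act (GenInv i) v = v[i - 1 := 2 * v ! (i - 1) - v ! i, i := v ! (i - 1)]"

text \<open>A right action: the leftmost letter of a word acts first.\<close>

definition word_act :: "int list \<Rightarrow> braid_letter list \<Rightarrow> int list" where
  "word_act v w = fold letter_act w v"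

text \<open>
  All words representing a braid act in the same way on a vector of the right length
  (lemma \<open>hurwitz_act_class\<close>), so the set under \<open>the_elem\<close> is a singleton.
\<close>

definition hurwitz_act :: "int list \<Rightarrow> braid_letter list set \<Rightarrow> int list" where
  "hurwitz_act v \<beta> = the_elem (word_act v ` \<beta>)"

definition hurwitz_rel :: "nat \<Rightarrow> (int list \<times> int list) set" where
  "hurwitz_rel m = {(v, w). v \<in> int_vecs m \<and> w \<in> int_vecs m \<and>
     (\<exists>\<beta> \<in> carrier (braid_group m). hurwitz_act v \<beta> = w)}"

lemma length_letter_act [simp]: "length (letter_act l v) = length v"
  by (cases l) auto

lemma word_act_Nil [simp]: "word_act v [] = v"
  and word_act_append: "word_act v (u @ w) = word_act (word_act v u) w"
  by (simp_all add: word_act_def)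

lemma length_word_act [simp]: "length (word_act v w) = length v"
  by (induction w arbitrary: v) (simp_all add: word_act_def)

lemma word_act_cong:
  "braid_eq m u u' \<Longrightarrow> length v = m \<Longrightarrow> word_act v u = word_act v u'"
proof (induction arbitrary: v rule: braid_eq.induct)
  case (append u u' w w')
  then show ?case by (simp add: word_act_append)
qed (auto simp: word_act_def nth_list_update intro!: nth_equalityI)

lemma hurwitz_act_class:
  assumes "v \<in> int_vecs m" "w \<in> braid_words m"
  shows "hurwitz_act v (braid_rel m `` {w}) = word_act v w"
proof -
  have "word_act v ` (braid_rel m `` {w}) = {word_act v w}"
    using assms word_act_cong[of m w _ v]
    by (force simp: braid_rel_def int_vecs_def intro: braid_eq.refl)
  then show ?thesis by (simp add: hurwitz_act_def)
qed

lemma hurwitz_act_gen: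
  assumes "length as = i - 1" "1 \<le> i" "length (as @ a # b # bs) = m"
  shows "hurwitz_act (as @ a # b # bs) (braid_gen m i) = as @ b # (2 * b - a) # bs"
proof -
  have "i < m" using assms by auto
  moreover obtain j where "i = Suc j" using assms(2) by (cases i) auto
  ultimately show ?thesis using assms
    by (simp add: braid_gen_def hurwitz_act_class int_vecs_def braid_words_def word_act_def
        nth_append list_update_append)
qed

lemma hurwitz_act_closed:
  assumes "v \<in> int_vecs m" "\<beta> \<in> carrier (braid_group m)"
  shows "hurwitz_act v \<beta> \<in> int_vecs m"
  using assms by (auto simp: braid_group_def hurwitz_act_class elim!: quotientE)
    (simp add: int_vecs_def)

lemma hurwitz_act_one:
  "v \<in> int_vecs m \<Longrightarrow> hurwitz_act v \<one>\<^bsub>braid_group m\<^esub> = v"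
  by (simp add: braid_group_def hurwitz_act_class)

lemma hurwitz_act_mult:
  assumes "v \<in> int_vecs m" "\<beta> \<in> carrier (braid_group m)" "\<gamma> \<in> carrier (braid_group m)"
  shows "hurwitz_act v (\<beta> \<otimes>\<^bsub>braid_group m\<^esub> \<gamma>) = hurwitz_act (hurwitz_act v \<beta>) \<gamma>"
proof -
  obtain u w where uw: "u \<in> braid_words m" "\<beta> = braid_rel m `` {u}"
      "w \<in> braid_words m" "\<gamma> = braid_rel m `` {w}"
    using assms(2,3) by (auto simp: braid_group_def elim!: quotientE)
  moreover have "word_act v u \<in> int_vecs m"
    using assms(1) by (simp add: int_vecs_def)
  ultimately show ?thesis
    using assms(1) by (simp add: braid_mult_class hurwitz_act_class word_act_append)
qed

lemma equiv_hurwitz_rel: "equiv (int_vecs m) (hurwitz_rel m)"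
proof (rule equivI)
  interpret group "braid_group m" by (rule group_braid_group)
  show "hurwitz_rel m \<subseteq> int_vecs m \<times> int_vecs m"
    by (auto simp: hurwitz_rel_def)
  show "refl_on (int_vecs m) (hurwitz_rel m)"
    by (auto simp: refl_on_def hurwitz_rel_def intro: bexI[of _ "\<one>\<^bsub>braid_group m\<^esub>"] hurwitz_act_one)
  show "sym (hurwitz_rel m)"
  proof (rule symI)
    fix v w assume "(v, w) \<in> hurwitz_rel m"
    then obtain \<beta> where b: "v \<in> int_vecs m" "w \<in> int_vecs m" "\<beta> \<in> carrier (braid_group m)"
        "hurwitz_act v \<beta> = w"
      by (auto simp: hurwitz_rel_def)
    then have "hurwitz_act w (inv\<^bsub>braid_group m\<^esub> \<beta>) = v"
      using hurwitz_act_mult[OF b(1) b(3) inv_closed[OF b(3)]] by (simp add: hurwitz_act_one)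
    with b show "(w, v) \<in> hurwitz_rel m"
      by (auto simp: hurwitz_rel_def)
  qed
  show "trans (hurwitz_rel m)"
  proof (rule transI)
    fix u v w assume "(u, v) \<in> hurwitz_rel m" "(v, w) \<in> hurwitz_rel m"
    then obtain \<beta> \<gamma> where
        b: "u \<in> int_vecs m" "\<beta> \<in> carrier (braid_group m)" "hurwitz_act u \<beta> = v" and
        c: "w \<in> int_vecs m" "\<gamma> \<in> carrier (braid_group m)" "hurwitz_act v \<gamma> = w"
      by (auto simp: hurwitz_rel_def)
    then have "hurwitz_act u (\<beta> \<otimes>\<^bsub>braid_group m\<^esub> \<gamma>) = w"
      by (simp add: hurwitz_act_mult)
    moreover have "\<beta> \<otimes>\<^bsub>braid_group m\<^esub> \<gamma> \<in> carrier (braid_group m)"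
      using b c by simp
    ultimately show "(u, w) \<in> hurwitz_rel m"
      using b c unfolding hurwitz_rel_def by blast
  qed
qed

section \<open>Systems of representatives\<close>

definition complete_reps :: "'a set \<Rightarrow> ('a \<times> 'a) set \<Rightarrow> 'a set \<Rightarrow> bool" where
  "complete_reps A r S \<longleftrightarrow> S \<subseteq> A \<and> (\<forall>C \<in> A // r. \<exists>!s. s \<in> S \<inter> C)"

definition const_vecs :: "nat \<Rightarrow> int list set" where
  "const_vecs k = {replicate (2 * k) x | x. True}"

definition D_set :: "nat \<Rightarrow> int list set" where
  "D_set k = {[x, x + (2 * n - 1) * (y - x)] @ replicate (2 * k - 2) y | x y n.
     0 \<le> 2 * x \<and> 2 * x < y}"

definition E_set :: "nat \<Rightarrow> nat \<Rightarrow> int list set" where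
  "E_set k p = {replicate p x @ [x + 2 * n * (y - x)] @ replicate (2 * k - p - 1) y | x y n.
     0 \<le> 2 * x \<and> 2 * x < y}"

end

theory Submission
  imports Defs "HOL-Library.Multiset"
begin

text \<open>
  On differences of consecutive entries, \<open>\<sigma>\<^sub>i\<close> adds the \<open>i\<close>-th one to or subtracts it from its
  neighbours, so the Euclidean algorithm brings three adjacent entries to the form \<open>(z, z, w)\<close>.
  A pair \<open>(z, z)\<close> commutes with every entry and may be reflected in any of them. Hence every
  vector of even length is equivalent to a list of pairs followed by \<open>(a, a + h)\<close>. Exchanging \<open>a\<close> with
  the value of a pair by the Euclidean algorithm, one lowers \<open>g = gcd (c - a) h\<close> for some pair \<open>(c, c)\<close>
  until \<open>g\<close> is the gcd of all differences. Reflections then leave only two pair values \<open>x\<close> and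
  \<open>x + g\<close> with \<open>0 \<le> x < g\<close>; the parity of \<open>h / g\<close> and the values that occur distinguish
  \<open>D\<close> and the \<open>E\<^sub>p\<close>.

  The representatives are told apart by the gcd \<open>d\<close> of the differences, the number of entries in
  each residue class modulo \<open>2d\<close>, and the alternating sum.
\<close>

section \<open>The Hurwitz relation as a rewriting relation\<close>

text \<open>The equivalence closure of one generator move. Symmetry accounts for the inverse
  generators, so once \<open>hurwitz_rel_iff\<close> is available the arguments run without braid
  words.\<close>

inductive hequiv :: "int list \<Rightarrow> int list \<Rightarrow> bool" (infix "\<approx>" 50) where
  refl: "v \<approx> v"
| sym: "u \<approx> v \<Longrightarrow> v \<approx> u"
| trans: "u \<approx> v \<Longrightarrow> v \<approx> w \<Longrightarrow> u \<approx> w"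
| step: "as @ a # b # bs \<approx> as @ b # (2 * b - a) # bs"

declare hequiv.trans [trans]

lemma hequiv_length: "u \<approx> v \<Longrightarrow> length u = length v"
  by (induction rule: hequiv.induct) auto

lemma hequiv_letter_act_Gen:
  assumes "Suc j < length v"
  shows "v \<approx> letter_act (Gen (Suc j)) v"
proof -
  have "v = take j v @ v ! j # v ! Suc j # drop (Suc (Suc j)) v"
    using assms by (metis Cons_nth_drop_Suc Suc_lessD append_take_drop_id)
  then obtain as a b bs where v: "v = as @ a # b # bs" "length as = j"
    using assms by (metis length_take Suc_lessD less_imp_le min.absorb2)
  have "letter_act (Gen (Suc j)) v = as @ b # (2 * b - a) # bs"
    using v by (simp add: nth_append list_update_append)
  with v show ?thesis by (simp add: hequiv.step)
qed

lemma hequiv_letter_act: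
  assumes "[l] \<in> braid_words (length v)"
  shows "v \<approx> letter_act l v"
proof (cases l)
  case (Gen i)
  then show ?thesis
    using assms hequiv_letter_act_Gen[of "i - 1" v] by (auto simp: braid_words_def)
next
  case (GenInv i)
  let ?u = "letter_act l v"
  have i: "1 \<le> i" "i < length v" using assms GenInv by (auto simp: braid_words_def)
  have "letter_act (Gen i) ?u = v"
    using i GenInv by (auto intro!: nth_equalityI simp: nth_list_update)
  moreover have "?u \<approx> letter_act (Gen i) ?u"
    using i hequiv_letter_act_Gen[of "i - 1" ?u] by simp
  ultimately show ?thesis by (simp add: hequiv.sym)
qed

lemma hequiv_word_act:
  "w \<in> braid_words (length v) \<Longrightarrow> v \<approx> word_act v w"
proof (induction w arbitrary: v)
  case (Cons l w)
  then have "v \<approx> letter_act l v" "letter_act l v \<approx> word_act (letter_act l v) w"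
    by (auto intro!: hequiv_letter_act simp: braid_words_def)
  then show ?case by (auto simp: word_act_def intro: hequiv.trans)
qed (simp add: hequiv.refl)

lemma hequiv_imp_hurwitz_rel:
  "u \<approx> v \<Longrightarrow> (u, v) \<in> hurwitz_rel (length u)"
proof (induction rule: hequiv.induct)
  case (refl v)
  then show ?case
    using equiv_hurwitz_rel[of "length v"] by (auto simp: equiv_def refl_on_def int_vecs_def)
next
  case (sym u v)
  then show ?case
    using equiv_hurwitz_rel[of "length u"] hequiv_length[OF sym.hyps]
    by (auto simp: equiv_def dest: symD)
next
  case (trans u v w)
  then show ?case
    using equiv_hurwitz_rel[of "length u"] hequiv_length[OF trans.hyps(1)]
    by (auto simp: equiv_def dest: transD)
next
  case (step as a b bs)
  let ?v = "as @ a # b # bs" and ?i = "Suc (length as)"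
  have "hurwitz_act ?v (braid_gen (length ?v) ?i) = as @ b # (2 * b - a) # bs"
    by (intro hurwitz_act_gen) auto
  moreover have "braid_gen (length ?v) ?i \<in> carrier (braid_group (length ?v))"
    by (auto simp: braid_gen_def braid_group_def braid_words_def intro!: quotientI)
  ultimately show ?case
    unfolding hurwitz_rel_def by (auto simp: int_vecs_def intro!: bexI)
qed

lemma hurwitz_rel_iff:
  "(u, v) \<in> hurwitz_rel m \<longleftrightarrow> length u = m \<and> u \<approx> v"
proof
  assume "(u, v) \<in> hurwitz_rel m"
  then obtain \<beta> where *: "u \<in> int_vecs m" "\<beta> \<in> carrier (braid_group m)" "hurwitz_act u \<beta> = v"
    by (auto simp: hurwitz_rel_def)
  then obtain w where "w \<in> braid_words m" "\<beta> = braid_rel m `` {w}"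
    by (auto simp: braid_group_def elim!: quotientE)
  with * show "length u = m \<and> u \<approx> v"
    using hurwitz_act_class hequiv_word_act by (auto simp: int_vecs_def)
qed (auto intro: hequiv_imp_hurwitz_rel)

text \<open>Splits the task into existence, settled by reduction to normal form, and pairwise
  inequivalence, settled by invariants.\<close>

lemma complete_reps_hurwitz_iff:
  "complete_reps (int_vecs m) (hurwitz_rel m) S \<longleftrightarrow>
     S \<subseteq> int_vecs m \<and> (\<forall>v. length v = m \<longrightarrow> (\<exists>s\<in>S. v \<approx> s)) \<and>
     (\<forall>s\<in>S. \<forall>t\<in>S. s \<approx> t \<longrightarrow> s = t)"
proof -
  have cls: "hurwitz_rel m `` {v} = {s. v \<approx> s}" if "length v = m" for v
    using that by (auto simp: hurwitz_rel_iff)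
  have "(\<forall>C\<in>int_vecs m // hurwitz_rel m. \<exists>!s. s \<in> S \<inter> C) \<longleftrightarrow>
      (\<forall>v. length v = m \<longrightarrow> (\<exists>!s. s \<in> S \<and> v \<approx> s))"
    by (auto simp: quotient_def int_vecs_def cls)
  moreover have "(\<forall>v. length v = m \<longrightarrow> (\<exists>!s. s \<in> S \<and> v \<approx> s)) \<longleftrightarrow>
      (\<forall>v. length v = m \<longrightarrow> (\<exists>s\<in>S. v \<approx> s)) \<and> (\<forall>s\<in>S. \<forall>t\<in>S. s \<approx> t \<longrightarrow> s = t)"
    if "S \<subseteq> int_vecs m"
  proof (intro iffI conjI allI impI ballI)
    fix s t assume *: "\<forall>v. length v = m \<longrightarrow> (\<exists>!s. s \<in> S \<and> v \<approx> s)" "s \<in> S" "t \<in> S" "s \<approx> t"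
    moreover have "length s = m" using * that by (auto simp: int_vecs_def)
    ultimately show "s = t" using hequiv.refl by blast
  qed (blast intro: hequiv.sym hequiv.trans)+
  ultimately show ?thesis unfolding complete_reps_def by (simp only:) (simp cong: conj_cong)
qed

section \<open>Invariants\<close>

fun alt_sum :: "int list \<Rightarrow> int" where
  "alt_sum [] = 0"
| "alt_sum (a # v) = a - alt_sum v"

definition all_cong :: "int \<Rightarrow> int list \<Rightarrow> bool" where
  "all_cong d v \<longleftrightarrow> (\<forall>x\<in>set v. \<forall>y\<in>set v. d dvd x - y)"

definition residue_count :: "int \<Rightarrow> int \<Rightarrow> int list \<Rightarrow> nat" where
  "residue_count d r v = length (filter (\<lambda>x. 2 * d dvd x - r) v)"

lemma alt_sum_append: "alt_sum (u @ v) = alt_sum u + (-1) ^ length u * alt_sum v"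
  by (induction u) auto

lemma hequiv_alt_sum: "u \<approx> v \<Longrightarrow> alt_sum u = alt_sum v"
  by (induction rule: hequiv.induct) (auto simp: alt_sum_append)

lemma all_cong_iff_base:
  "x \<in> set v \<Longrightarrow> all_cong d v \<longleftrightarrow> (\<forall>y\<in>set v. d dvd y - x)"
  unfolding all_cong_def
proof safe
  fix y z assume *: "\<forall>y\<in>set v. d dvd y - x" "y \<in> set v" "z \<in> set v"
  then have "d dvd (y - x) - (z - x)" by (blast intro: dvd_diff)
  then show "d dvd y - z" by simp
qed auto

text \<open>The entry \<open>b\<close> survives the move and \<open>(2 * b - a) - b = b - a\<close>,
  so it suffices to compare every entry with \<open>b\<close>.\<close>

lemma hequiv_all_cong: "u \<approx> v \<Longrightarrow> all_cong d u \<longleftrightarrow> all_cong d v"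
proof (induction rule: hequiv.induct)
  case (step as a b bs)
  have eq: "d dvd (2 * b - a) - b \<longleftrightarrow> d dvd a - b"
    using dvd_minus_iff[of d "a - b"] by (simp add: algebra_simps)
  have "all_cong d (as @ a # b # bs) \<longleftrightarrow> (\<forall>y\<in>set (as @ a # b # bs). d dvd y - b)"
    by (rule all_cong_iff_base) simp
  moreover have "all_cong d (as @ b # (2*b-a) # bs) \<longleftrightarrow> (\<forall>y\<in>set (as @ b # (2*b-a) # bs). d dvd y - b)"
    by (rule all_cong_iff_base) simp
  ultimately show ?case using eq by auto
qed auto

text \<open>A move replaces \<open>a\<close> by \<open>2 * b - a = a + 2 * (b - a)\<close>. Since
  \<open>d\<close> divides \<open>b - a\<close>, the residues modulo \<open>2 * d\<close> are merely
  permuted.\<close>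

lemma hequiv_residue_count:
  "u \<approx> v \<Longrightarrow> all_cong d u \<Longrightarrow> residue_count d r u = residue_count d r v"
proof (induction rule: hequiv.induct)
  case (step as a b bs)
  then have "d dvd b - a" by (auto simp: all_cong_def)
  then have "2 * d dvd 2 * (b - a)" by (rule mult_dvd_mono[OF dvd_refl])
  then have "2 * d dvd (a - r) + 2 * (b - a) \<longleftrightarrow> 2 * d dvd a - r" by (rule dvd_add_left_iff)
  then have "2 * d dvd 2 * b - a - r \<longleftrightarrow> 2 * d dvd a - r" by (simp add: algebra_simps)
  then show ?case by (auto simp: residue_count_def)
qed (auto simp: hequiv_all_cong)

lemma residue_count_pos_iff: "0 < residue_count d r v \<longleftrightarrow> (\<exists>x\<in>set v. 2 * d dvd x - r)"
  by (auto simp: residue_count_def filter_empty_conv)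

lemma residue_count_append [simp]:
  "residue_count d r (u @ v) = residue_count d r u + residue_count d r v"
  and residue_count_Nil [simp]: "residue_count d r [] = 0"
  and residue_count_Cons [simp]: "residue_count d r (a # v) =
    (if 2 * d dvd a - r then 1 else 0) + residue_count d r v"
  and residue_count_replicate [simp]: "residue_count d r (replicate n a) =
    (if 2 * d dvd a - r then n else 0)"
  by (auto simp: residue_count_def)

section \<open>Separating the representatives\<close>

text \<open>Here \<open>d\<close> is the gcd of all differences, since \<open>x\<close> and
  \<open>x + d\<close> both occur, and \<open>x\<close> is the common residue of the entries modulo
  \<open>d\<close>. The count \<open>c\<close> is \<open>1\<close> on \<open>D_set k\<close> and
  \<open>p + 1\<close> on \<open>E_set k p\<close>.\<close>

definition has_profile :: "int list \<Rightarrow> int \<Rightarrow> int \<Rightarrow> nat \<Rightarrow> bool" where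
  "has_profile v d x c \<longleftrightarrow> 0 \<le> x \<and> x < d \<and> x \<in> set v \<and> x + d \<in> set v \<and>
     (\<forall>y\<in>set v. d dvd y - x) \<and> residue_count d x v = c"

text \<open>Makes \<open>d\<close> recoverable: \<open>all_cong\<close> is invariant, and a positive
  integer is determined by its divisors.\<close>

lemma has_profile_all_cong_iff:
  assumes "has_profile v d x c"
  shows "all_cong e v \<longleftrightarrow> e dvd d"
proof
  assume "all_cong e v"
  with assms have "e dvd (x + d) - x"
    unfolding has_profile_def all_cong_def by blast
  then show "e dvd d" by simp
next
  assume "e dvd d"
  with assms show "all_cong e v"
    by (auto simp: has_profile_def all_cong_iff_base[of x] intro: dvd_trans)
qed

lemma has_profile_unique:
  assumes "u \<approx> v" "has_profile u d x c" "has_profile v d' x' c'"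
  shows "d = d'" "x = x'" "c = c'"
proof -
  have u: "all_cong e u \<longleftrightarrow> e dvd d" and v: "all_cong e v \<longleftrightarrow> e dvd d'" for e
    using has_profile_all_cong_iff assms(2,3) by blast+
  have "d dvd d'" "d' dvd d" "d > 0" "d' > 0"
    using u[of d] v[of d'] v[of d] u[of d'] hequiv_all_cong[OF assms(1)] assms(2,3) by (auto simp: has_profile_def)
  then show d: "d = d'" by (simp add: zdvd_antisym_nonneg)
  have c: "residue_count d x u = residue_count d x v"
    using hequiv_residue_count[OF assms(1)] u by auto
  \<comment> \<open>The profile of \<open>v\<close> ties its entries to \<open>x'\<close> only. The
    positive count carries an entry congruent to \<open>x\<close> over to \<open>v\<close>, which
    links \<open>x\<close> with \<open>x'\<close> modulo \<open>d\<close>.\<close>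
  have "0 < residue_count d x u"
    using assms(2) by (auto simp: residue_count_pos_iff has_profile_def intro!: bexI[of _ x])
  then obtain y where y: "y \<in> set v" "2 * d dvd y - x"
    unfolding c by (auto simp: residue_count_pos_iff)
  have "d dvd y - x" using y(2) by (rule dvd_mult_right)
  moreover have "d dvd y - x'" using assms(3) y(1) d by (auto simp: has_profile_def)
  ultimately have "d dvd (y - x') - (y - x)" by (rule dvd_diff[rotated])
  then have "x mod d = x' mod d" by (simp add: mod_eq_dvd_iff)
  then show x: "x = x'" using assms(2,3) d by (simp add: has_profile_def)
  show "c = c'" using c assms(2,3) d x by (simp add: has_profile_def)
qed

text \<open>With \<open>d = y - x\<close> the bounds become \<open>0 \<le> x\<close> and
  \<open>x < d\<close>. Every entry after the first differs from \<open>x\<close> by an odd multiple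
  of \<open>d\<close>, so only the first is counted.\<close>

lemma D_set_profile:
  assumes "k \<ge> 2" "s \<in> D_set k"
  obtains d x n where "has_profile s d x 1"
    "s = [x, x + (2 * n - 1) * d] @ replicate (2 * k - 2) (x + d)"
proof -
  obtain x y n where s: "s = [x, x + (2 * n - 1) * (y - x)] @ replicate (2 * k - 2) y"
     "0 \<le> 2 * x" "2 * x < y"
    using assms by (auto simp: D_set_def)
  define d where "d = y - x"
  have y: "y = x + d" by (simp add: d_def)
  have d: "0 \<le> x" "x < d" using s by (auto simp: d_def)
  have odd: "\<not> 2 * d dvd (2 * n - 1) * d" for n using d by (subst dvd_mult_cancel_right) auto
  from odd[of n] odd[of 1] have "has_profile s d x 1"
    using d assms unfolding s(1) y has_profile_def by auto
  then show ?thesis using that s(1) by (simp add: y)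
qed

text \<open>The free entry differs from \<open>x\<close> by an even multiple of \<open>d\<close>, so
  it is counted along with the \<open>p\<close> copies of \<open>x\<close>. The range of
  \<open>p\<close> ensures that both \<open>x\<close> and \<open>x + d\<close> occur.\<close>

lemma E_set_profile:
  assumes "p \<in> {1..2 * k - 2}" "s \<in> E_set k p"
  obtains d x n where "has_profile s d x (p + 1)"
    "s = replicate p x @ [x + 2 * n * d] @ replicate (2 * k - p - 1) (x + d)"
proof -
  obtain x y n where s: "s = replicate p x @ [x + 2 * n * (y - x)] @ replicate (2 * k - p - 1) y"
     "0 \<le> 2 * x" "2 * x < y"
    using assms by (auto simp: E_set_def)
  define d where "d = y - x"
  have y: "y = x + d" by (simp add: d_def)
  have d: "0 \<le> x" "x < d" using s by (auto simp: d_def)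
  have "\<not> 2 * d dvd d" using d by (auto dest: zdvd_imp_le)
  moreover have "2 * d dvd 2 * n * d" by (simp only: mult.assoc mult.left_commute dvd_triv_right)
  moreover have "x \<in> set s" "x + d \<in> set s" "\<forall>z\<in>set s. d dvd z - x"
    using assms(1) by (auto simp: s(1) y)
  ultimately have "has_profile s d x (p + 1)"
    using d by (simp add: s(1) y has_profile_def)
  then show ?thesis using that s(1) by (simp add: y)
qed

text \<open>A constant vector is congruent modulo \<open>0\<close>, which would force
  \<open>0 dvd d\<close>, whereas a profile has \<open>d > 0\<close>.\<close>

lemma const_vecs_no_profile:
  assumes "s \<in> const_vecs k" "s \<approx> t" "has_profile t d x c"
  shows False
proof -
  have "all_cong 0 s" using assms(1) by (auto simp: const_vecs_def all_cong_def)
  then have "all_cong 0 t" using assms(2) hequiv_all_cong by blast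
  then have "0 dvd d" using has_profile_all_cong_iff[OF assms(3)] by blast
  then show False using assms(3) by (auto simp: has_profile_def)
qed

lemma const_vecs_unique:
  assumes "s \<in> const_vecs k" "t \<in> const_vecs k" "s \<approx> t"
  shows "s = t"
proof -
  obtain x y where xy: "s = replicate (2 * k) x" "t = replicate (2 * k) y"
    using assms by (auto simp: const_vecs_def)
  \<comment> \<open>Congruence modulo \<open>0\<close> is equality.\<close>
  have "residue_count 0 x s = residue_count 0 x t"
    using assms(3) xy by (intro hequiv_residue_count) (auto simp: all_cong_def)
  then show ?thesis by (auto simp: xy split: if_splits)
qed

text \<open>The profile fixes \<open>d\<close> and \<open>x\<close>; the alternating sum then fixes
  the remaining entry.\<close>

lemma D_set_unique:
  assumes "k \<ge> 2" "s \<in> D_set k" "t \<in> D_set k" "s \<approx> t"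
  shows "s = t"
proof -
  obtain d x n where s: "has_profile s d x 1"
    "s = [x, x + (2 * n - 1) * d] @ replicate (2 * k - 2) (x + d)"
    using D_set_profile assms by metis
  obtain d' x' n' where t: "has_profile t d' x' 1"
    "t = [x', x' + (2 * n' - 1) * d'] @ replicate (2 * k - 2) (x' + d')"
    using D_set_profile assms by metis
  have eq: "d = d'" "x = x'" using has_profile_unique[OF assms(4) s(1) t(1)] by auto
  then show ?thesis using hequiv_alt_sum[OF assms(4)] by (simp add: s(2) t(2))
qed

lemma E_set_unique:
  assumes "p \<in> {1..2 * k - 2}" "q \<in> {1..2 * k - 2}" "s \<in> E_set k p" "t \<in> E_set k q" "s \<approx> t"
  shows "p = q" "s = t"
proof -
  obtain d x n where s: "has_profile s d x (p + 1)"
    "s = replicate p x @ [x + 2 * n * d] @ replicate (2 * k - p - 1) (x + d)"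
    using E_set_profile assms by metis
  obtain d' x' n' where t: "has_profile t d' x' (q + 1)"
    "t = replicate q x' @ [x' + 2 * n' * d'] @ replicate (2 * k - q - 1) (x' + d')"
    using E_set_profile assms by metis
  have eq: "d = d'" "x = x'" "p + 1 = q + 1"
    using has_profile_unique[OF assms(5) s(1) t(1)] by auto
  then show "p = q" by simp
  with eq show "s = t"
    using hequiv_alt_sum[OF assms(5)] by (simp add: s(2) t(2) alt_sum_append)
qed

lemma D_E_set_not_hequiv:
  assumes "k \<ge> 2" "p \<in> {1..2 * k - 2}" "s \<in> D_set k" "t \<in> E_set k p"
  shows "\<not> s \<approx> t"
proof
  assume "s \<approx> t"
  moreover obtain d x where "has_profile s d x 1" using D_set_profile assms by metis
  moreover obtain d' x' where "has_profile t d' x' (p + 1)" using E_set_profile assms by metis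
  ultimately have "1 = p + 1" by (rule has_profile_unique(3))
  then show False using assms by simp
qed

section \<open>Reduction to normal form\<close>

lemma hequiv_context: "u \<approx> v \<Longrightarrow> as @ u @ bs \<approx> as @ v @ bs"
proof (induction rule: hequiv.induct)
  case (step as' a b bs')
  show ?case using hequiv.step[of "as @ as'" a b "bs' @ bs"] by simp
qed (auto intro: hequiv.refl hequiv.sym hequiv.trans)

lemma hequiv_iterate:
  fixes e j :: int
  assumes "\<And>b. f b \<approx> f (b + e)"
  shows "f b \<approx> f (b + e * j)"
proof -
  have nat: "f b \<approx> f (b + e * int n)" for b n
  proof (induction n)
    case (Suc n)
    note Suc.IH
    also have "f (b + e * int n) \<approx> f (b + e * int n + e)" by (rule assms)
    finally show ?case by (simp add: algebra_simps)
  qed (simp add: hequiv.refl)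
  show ?thesis
    \<comment> \<open>For negative \<open>j\<close>, one climbs from \<open>b + e * j\<close> up to
      \<open>b\<close> and reverses the equivalence.\<close>
    using nat[of b "nat j"] hequiv.sym[OF nat[of "b + e * j" "nat (- j)"]]
    by (cases "j \<ge> 0") simp_all
qed

section \<open>Pairs of equal entries\<close>

text \<open>While passing the pair, \<open>c\<close> is reflected in \<open>a\<close> twice and so
  comes out unchanged.\<close>

lemma pair_past: "[c, a, a] \<approx> [a, a, c]"
  using hequiv.step[of "[]" c a "[a]"] hequiv.step[of "[a]" "2 * a - c" a "[]"]
  by (auto intro: hequiv.trans)

lemma pair_past_list: "u @ [a, a] \<approx> [a, a] @ u"
proof (induction u)
  case (Cons c u)
  have "(c # u) @ [a, a] \<approx> [c] @ ([a, a] @ u) @ []"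
    using hequiv_context[OF Cons.IH, of "[c]" "[]"] by simp
  also have "\<dots> \<approx> [a, a] @ (c # u)"
    using hequiv_context[OF pair_past, of "[]" c a u] by simp
  finally show ?case .
qed (simp add: hequiv.refl)

text \<open>The pair is brought next to \<open>c\<close>. As \<open>c\<close> passes to its left,
  each half \<open>a\<close> turns into \<open>2 * c - a\<close>, and the new pair can travel
  back.\<close>

lemma pair_reflect:
  assumes "c \<in> set u"
  shows "[a, a] @ u \<approx> [2 * c - a, 2 * c - a] @ u"
proof -
  obtain u1 u2 where u: "u = u1 @ [c] @ u2" using split_list[OF assms] by auto
  let ?b = "2 * c - a"
  have "[a, a, c] \<approx> [a, c, ?b]" using hequiv.step[of "[a]" a c "[]"] by simp
  also have "\<dots> \<approx> [c, ?b, ?b]" using hequiv.step[of "[]" a c "[?b]"] by simp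
  also have "\<dots> \<approx> [?b, ?b, c]" by (rule pair_past)
  finally have *: "[a, a, c] \<approx> [?b, ?b, c]" .
  have "[a, a] @ u \<approx> u1 @ [a, a, c] @ u2"
    using hequiv_context[OF hequiv.sym[OF pair_past_list], of "[]" a u1 "[c] @ u2"] u by simp
  also have "\<dots> \<approx> u1 @ [?b, ?b, c] @ u2" by (rule hequiv_context[OF *])
  also have "\<dots> \<approx> [?b, ?b] @ u"
    using hequiv_context[OF pair_past_list, of "[]" u1 ?b "[c] @ u2"] u by simp
  finally show ?thesis .
qed

text \<open>The composite of the reflections in \<open>x\<close> and in \<open>y\<close> is the
  translation by \<open>2 * (y - x)\<close>.\<close>

lemma pair_translate:
  assumes "x \<in> set u" "y \<in> set u"
  shows "[a, a] @ u \<approx> [a + 2 * j * (y - x), a + 2 * j * (y - x)] @ u"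
proof -
  have step: "[b, b] @ u \<approx> [b + 2 * (y - x), b + 2 * (y - x)] @ u" for b
  proof -
    have "[b, b] @ u \<approx> [2 * x - b, 2 * x - b] @ u" by (rule pair_reflect[OF assms(1)])
    also have "\<dots> \<approx> [2 * y - (2 * x - b), 2 * y - (2 * x - b)] @ u"
      by (rule pair_reflect[OF assms(2)])
    finally show ?thesis by (simp add: algebra_simps)
  qed
  have "[a, a] @ u \<approx> [a + 2 * (y - x) * j, a + 2 * (y - x) * j] @ u"
    by (rule hequiv_iterate[of "\<lambda>b. [b, b] @ u"], rule step)
  then show ?thesis by (simp only: mult_ac)
qed

text \<open>
  On the difference vector \<open>(b - a, c - b)\<close> the two generators act as elementary matrices,
  so this is the Euclidean algorithm; \<open>a - b + c\<close> is the invariant alternating sum.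
\<close>

lemma triple_euclid:
  "[a, b, c] \<approx> [a - b + c - gcd (b - a) (c - b), a - b + c - gcd (b - a) (c - b), a - b + c]"
proof (induction "nat (\<bar>b - a\<bar> + \<bar>c - b\<bar>)" arbitrary: a b c rule: less_induct)
  case less
  \<comment> \<open>The base case: reflecting in \<open>y\<close> if necessary puts the pair below
    \<open>y\<close>, which matches the sign of the nonnegative gcd.\<close>
  have pair: "[x, x, y] \<approx> [y - \<bar>x - y\<bar>, y - \<bar>x - y\<bar>, y]" for x y
    using pair_reflect[of y "[y]" x] by (auto simp: abs_if hequiv.refl)
  have reduce: ?case if "[a, b, c] \<approx> [a', b', c']"
    "\<bar>b' - a'\<bar> + \<bar>c' - b'\<bar> < \<bar>b - a\<bar> + \<bar>c - b\<bar>"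
    "gcd (b' - a') (c' - b') = gcd (b - a) (c - b)" "a' - b' + c' = a - b + c" for a' b' c'
  proof -
    have "nat (\<bar>b' - a'\<bar> + \<bar>c' - b'\<bar>) < nat (\<bar>b - a\<bar> + \<bar>c - b\<bar>)" using that(2) by linarith
    from hequiv.trans[OF that(1) less[OF this]] show ?thesis unfolding that(3,4) .
  qed
  \<comment> \<open>If neither difference vanishes, the one of larger absolute value shrinks
    strictly when the other is added or subtracted, depending on the signs.\<close>
  consider "b = a" | "c = b"
    | "\<bar>(b - a) - (c - b)\<bar> < \<bar>b - a\<bar>" | "\<bar>(b - a) + (c - b)\<bar> < \<bar>b - a\<bar>"
    | "\<bar>(c - b) - (b - a)\<bar> < \<bar>c - b\<bar>" | "\<bar>(c - b) + (b - a)\<bar> < \<bar>c - b\<bar>"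
    by linarith
  then show ?case
  proof cases
    case 1
    then show ?thesis using pair[of a c] by (simp add: abs_minus_commute)
  next
    case 2
    then show ?thesis using hequiv.trans[OF pair_past[of a b] pair[of b a]] by simp
  next
    case 3
    show ?thesis
    proof (rule reduce)
      show "[a, b, c] \<approx> [a, 2 * b - c, b]"
        using hequiv.sym[OF hequiv.step[of "[a]" "2 * b - c" b "[]"]] by simp
      show "\<bar>2 * b - c - a\<bar> + \<bar>b - (2 * b - c)\<bar> < \<bar>b - a\<bar> + \<bar>c - b\<bar>"
        using 3 by linarith
      have "2 * b - c - a = (b - a) - (c - b)" "b - (2 * b - c) = c - b" by simp_all
      then show "gcd (2 * b - c - a) (b - (2 * b - c)) = gcd (b - a) (c - b)"
        by (simp only: gcd_diff1)
    qed simp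
  next
    case 4
    show ?thesis
    proof (rule reduce)
      show "[a, b, c] \<approx> [a, c, 2 * c - b]"
        using hequiv.step[of "[a]" b c "[]"] by simp
      show "\<bar>c - a\<bar> + \<bar>2 * c - b - c\<bar> < \<bar>b - a\<bar> + \<bar>c - b\<bar>"
        using 4 by linarith
      have "c - a = (b - a) + (c - b)" "2 * c - b - c = c - b" by simp_all
      then show "gcd (c - a) (2 * c - b - c) = gcd (b - a) (c - b)"
        by (simp only: gcd_add1)
    qed simp
  next
    case 5
    show ?thesis
    proof (rule reduce)
      show "[a, b, c] \<approx> [b, 2 * b - a, c]"
        using hequiv.step[of "[]" a b "[c]"] by simp
      show "\<bar>2 * b - a - b\<bar> + \<bar>c - (2 * b - a)\<bar> < \<bar>b - a\<bar> + \<bar>c - b\<bar>"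
        using 5 by linarith
      have "c - (2 * b - a) = (c - b) - (b - a)" "2 * b - a - b = b - a" by simp_all
      then show "gcd (2 * b - a - b) (c - (2 * b - a)) = gcd (b - a) (c - b)"
        by (simp only: gcd_diff1 gcd.commute[of "b - a"])
    qed simp
  next
    case 6
    show ?thesis
    proof (rule reduce)
      show "[a, b, c] \<approx> [2 * a - b, a, c]"
        using hequiv.sym[OF hequiv.step[of "[]" "2 * a - b" a "[c]"]] by simp
      show "\<bar>a - (2 * a - b)\<bar> + \<bar>c - a\<bar> < \<bar>b - a\<bar> + \<bar>c - b\<bar>"
        using 6 by linarith
      have "c - a = (c - b) + (b - a)" "a - (2 * a - b) = b - a" by simp_all
      then show "gcd (a - (2 * a - b)) (c - a) = gcd (b - a) (c - b)"
        by (simp only: gcd_add1 gcd.commute[of "b - a"])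
    qed simp
  qed
qed

section \<open>Lists of pairs followed by two entries\<close>

definition dbl :: "int list \<Rightarrow> int list" where
  "dbl C = concat (map (\<lambda>c. [c, c]) C)"

lemma dbl_simps [simp]:
  "dbl [] = []" "dbl (c # C) = [c, c] @ dbl C" "dbl (C @ C') = dbl C @ dbl C'"
  by (simp_all add: dbl_def)

lemma dbl_replicate [simp]: "dbl (replicate n c) = replicate (2 * n) c"
  by (induction n) auto

lemma set_dbl [simp]: "set (dbl C) = set C"
  by (auto simp: dbl_def)

lemma dbl_past_list: "dbl C @ u \<approx> u @ dbl C"
proof (induction C)
  case (Cons c C)
  have "dbl (c # C) @ u \<approx> [c, c] @ (u @ dbl C) @ []"
    using hequiv_context[OF Cons.IH, of "[c, c]" "[]"] by simp
  also have "\<dots> \<approx> u @ dbl (c # C)"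
    using hequiv_context[OF hequiv.sym[OF pair_past_list], of "[]" c u "dbl C"] by simp
  finally show ?case .
qed (simp add: hequiv.refl)

lemma dbl_perm: "mset C = mset C' \<Longrightarrow> dbl C \<approx> dbl C'"
proof (induction C arbitrary: C')
  case (Cons c C)
  then have "c \<in> set C'" by (metis list.set_intros(1) set_mset_mset)
  then obtain C1 C2 where C': "C' = C1 @ c # C2" by (auto dest: split_list)
  with Cons.prems have "mset C = mset (C1 @ C2)" by simp
  note hequiv_context[OF Cons.IH[OF this], of "[c, c]" "[]"]
  also have "[c, c] @ dbl (C1 @ C2) @ [] \<approx> dbl C'"
    using hequiv_context[OF hequiv.sym[OF pair_past_list], of "[]" c "dbl C1" "dbl C2"]
    by (simp add: C')
  finally show ?case by simp
qed (simp add: hequiv.refl)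

text \<open>Pairs contribute nothing to the alternating sum, so it equals \<open>- h\<close>. Hence
  \<open>h\<close> stays fixed under every equivalence between such states, and only
  \<open>C\<close> and \<open>a\<close> change.\<close>

definition paired :: "int \<Rightarrow> int list \<Rightarrow> int \<Rightarrow> int list" where
  "paired h C a = dbl C @ [a, a + h]"

lemma paired_perm: "mset C = mset C' \<Longrightarrow> paired h C a \<approx> paired h C' a"
  unfolding paired_def using hequiv_context[OF dbl_perm, of C C' "[]"] by simp

text \<open>\<open>triple_euclid\<close> turns the first three entries into a pair and one entry,
  which joins the rest for the induction.\<close>

lemma hequiv_paired: "length v = 2 * k + 2 \<Longrightarrow> \<exists>C h a. length C = k \<and> v \<approx> paired h C a"
proof (induction k arbitrary: v)
  case 0
  then obtain a b where "v = [a, b]" by (auto simp: length_Suc_conv numeral_2_eq_2)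
  then have "v \<approx> paired (b - a) [] a" by (simp add: paired_def hequiv.refl)
  then show ?case by auto
next
  case (Suc k)
  then obtain a b c r where v: "v = [a, b, c] @ r" "length r = 2 * k + 1"
    by (auto simp: length_Suc_conv numeral_2_eq_2)
  obtain z w where "[a, b, c] \<approx> [z, z, w]" using triple_euclid by blast
  from hequiv_context[OF this, of "[]" r] have "v \<approx> [z, z] @ (w # r)" by (simp add: v)
  moreover obtain C h a where C: "length C = k" "w # r \<approx> paired h C a"
    using Suc.IH[of "w # r"] v by auto
  moreover have "[z, z] @ (w # r) \<approx> paired h (z # C) a"
    using hequiv_context[OF C(2), of "[z, z]" "[]"] by (simp add: paired_def)
  ultimately have "v \<approx> paired h (z # C) a" by (blast intro: hequiv.trans)
  then show ?case using C(1) by (intro exI[of _ "z # C"]) auto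
qed

lemma paired_reflect:
  assumes "e \<in> {a, a + h} \<union> set C"
  shows "paired h (c # C) a \<approx> paired h ((2 * e - c) # C) a"
  using assms pair_reflect[of e "dbl C @ [a, a + h]" c] by (auto simp: paired_def)

text \<open>One copy of \<open>c\<close> is set aside and \<open>triple_euclid\<close> is applied to
  \<open>[c, a, a + h]\<close>, whose alternating sum is \<open>c + h\<close>. The copy set aside
  and this \<open>c + h\<close> are the new last two entries.\<close>

lemma paired_exchange:
  assumes "gcd (c - a) h = g"
  shows "paired h (c # C) a \<approx> paired h ((c + h - g) # C) c"
proof -
  have g: "gcd (a - c) h = g" using assms by (metis gcd_neg1_int minus_diff_eq)
  let ?z = "c + h - g"
  have "[c, a, a + h] \<approx> [?z, ?z, c + h]" using triple_euclid[of c a "a + h"] g by simp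
  from hequiv_context[OF this, of "dbl C @ [c]" "[]"]
  have *: "dbl C @ [c, c, a, a + h] \<approx> (dbl C @ [c]) @ [?z, ?z] @ [c + h]" by simp
  have "paired h (c # C) a \<approx> dbl C @ [c, c, a, a + h]"
    using hequiv_context[OF hequiv.sym[OF pair_past_list], of "[]" c "dbl C" "[a, a + h]"]
    by (simp add: paired_def)
  also note *
  also have "(dbl C @ [c]) @ [?z, ?z] @ [c + h] \<approx> paired h (?z # C) c"
    using hequiv_context[OF pair_past_list, of "[]" "dbl C @ [c]" ?z "[c + h]"]
    by (simp add: paired_def)
  finally show ?thesis .
qed

text \<open>
  Every such state is equivalent to one of the shape \<open>N b\<close>. Exchanging its pair, with or without
  reflecting it first, takes \<open>N b\<close> to \<open>N (b + h - g)\<close> or \<open>N (b + h + g)\<close>, so \<open>b\<close> can be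
  translated by \<open>2 * g\<close>, and by \<open>g\<close> if \<open>2 * g\<close> divides \<open>h\<close>.
\<close>

lemma paired_move:
  assumes "gcd (c - a) h = g" "gcd (c' - a') h = g"
    and "2 * g dvd c' - c \<or> 2 * g dvd h \<and> g dvd c' - c"
  shows "paired h (c # C) a \<approx> paired h (c' # C) a'"
proof -
  define N where "N b = paired h ((b + h - g) # C) b" for b
  have gh: "g dvd h" "g \<ge> 0" using assms(1) by auto
  have gcds: "gcd (h - g) h = g" "gcd (h + g) h = g"
    using gh by (simp_all add: gcd_diff2 gcd_proj1_if_dvd_int gcd_add1 add.commute[of h])
  have down: "N b \<approx> N (b + h - g)" for b
    using paired_exchange[of "b + h - g" b h g C] gcds by (simp add: N_def)
  have up: "N b \<approx> N (b + h + g)" for b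
  proof -
    have "N b \<approx> paired h ((b + h + g) # C) b"
      using paired_reflect[of "b + h" b h C "b + h - g"] by (simp add: N_def algebra_simps)
    also have "\<dots> \<approx> N (b + h + g)"
      using paired_exchange[of "b + h + g" b h g C] gcds by (simp add: N_def)
    finally show ?thesis .
  qed
  \<comment> \<open>From \<open>b - h + g\<close> one move arrives at \<open>b\<close> and the other
    at \<open>b + 2 * g\<close>.\<close>
  have up2: "N b \<approx> N (b + 2 * g)" for b
    using hequiv.trans[OF hequiv.sym[OF down[of "b - h + g"]] up[of "b - h + g"]]
    by (simp add: algebra_simps)
  have even: "N b \<approx> N (b + 2 * g * j)" for b j
    using up2 by (rule hequiv_iterate)
  have "N c \<approx> N c'"
  proof (cases "2 * g dvd c' - c")
    case True
    then obtain j where "c' - c = 2 * g * j" by (auto elim: dvdE)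
    then have "c' = c + 2 * g * j" by simp
    then show ?thesis using even by simp
  next
    case False
    then obtain q where h: "h = 2 * g * q" using assms(3) by (auto elim: dvdE)
    obtain j where j: "c' - c = g * j" using False assms(3) by (auto elim: dvdE)
    have "odd j" using False by (auto simp: j elim!: evenE)
    then obtain i where i: "j = 2 * i + 1" by (auto elim: oddE)
    \<comment> \<open>One downward move supplies an odd multiple of \<open>g\<close>, because
      \<open>h\<close> is an even one; the rest is a translation by a multiple of
      \<open>2 * g\<close>.\<close>
    have c': "c' = c + h - g + 2 * g * (i + 1 - q)"
      using j by (simp add: h i algebra_simps)
    show ?thesis
      unfolding c' by (rule hequiv.trans[OF down even])
  qed
  moreover have "paired h (c # C) a \<approx> N c" "paired h (c' # C) a' \<approx> N c'"
    using assms by (auto simp: N_def intro: paired_exchange)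
  ultimately show ?thesis by (blast intro: hequiv.trans hequiv.sym)
qed

text \<open>Descent on the gcd. If \<open>g\<close> fails to divide \<open>x - a\<close> for a pair
  value \<open>x\<close>, then \<open>c\<close> and \<open>a\<close> are translated together by a
  multiple of \<open>2 * g\<close> until \<open>x\<close> is closer than \<open>g\<close> to the new
  \<open>a\<close>. Taking \<open>x\<close> as the distinguished pair makes the gcd smaller.\<close>

lemma paired_reduce:
  assumes "gcd (c - a) h > 0"
  shows "\<exists>c' C' a'. length C' = length C \<and> paired h (c # C) a \<approx> paired h (c' # C') a' \<and>
    gcd (c' - a') h > 0 \<and> (\<forall>x\<in>set C'. gcd (c' - a') h dvd x - a')"
  using assms
proof (induction "nat (gcd (c - a) h)" arbitrary: c C a rule: less_induct)
  case less
  define g where "g = gcd (c - a) h"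
  show ?case
  proof (cases "\<forall>x\<in>set C. g dvd x - a")
    case True
    then show ?thesis using less.prems hequiv.refl unfolding g_def by blast
  next
    case False
    then obtain x where x: "x \<in> set C" "\<not> g dvd x - a" by blast
    have gpos: "g > 0" using less.prems by (simp add: g_def)
    \<comment> \<open>Rounding that places \<open>x - a'\<close> in the interval from
      \<open>- g\<close> to \<open>g\<close>; the left end is excluded because \<open>g\<close> does
      not divide \<open>x - a'\<close>.\<close>
    define j where "j = (x - a + g) div (2 * g)"
    define a' where "a' = a + 2 * g * j"
    define c' where "c' = c + 2 * g * j"
    have "x - a' + g = (x - a + g) mod (2 * g)"
      by (simp add: a'_def j_def minus_div_mult_eq_mod [symmetric] algebra_simps)
    then have bounds: "x - a' + g \<ge> 0" "x - a' + g < 2 * g"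
      using gpos by auto
    have ndvd: "\<not> g dvd x - a'"
    proof
      assume "g dvd x - a'"
      then have "g dvd (x - a') + g * (2 * j)" by (rule dvd_add) simp
      then show False using x by (simp add: a'_def algebra_simps)
    qed
    have "\<bar>x - a'\<bar> < g" using bounds ndvd by (cases "x - a' = - g") auto
    moreover have nz: "x - a' \<noteq> 0" using ndvd by auto
    moreover have "gcd (x - a') h \<le> \<bar>x - a'\<bar>" using nz by (simp add: gcd_le1_int zdvd_imp_le)
    ultimately have small: "gcd (x - a') h < g" "gcd (x - a') h > 0" by auto
    obtain C1 C2 where C: "C = C1 @ x # C2" using split_list[OF x(1)] by auto
    have "paired h (c # C) a \<approx> paired h (c' # C) a'"
      by (rule paired_move[where g = g]) (auto simp: g_def c'_def a'_def)
    also have "\<dots> \<approx> paired h (x # c' # C1 @ C2) a'" by (rule paired_perm) (simp add: C)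
    finally have 1: "paired h (c # C) a \<approx> paired h (x # c' # C1 @ C2) a'" .
    have "nat (gcd (x - a') h) < nat (gcd (c - a) h)" using small g_def by auto
    from less.hyps[OF this small(2), of "c' # C1 @ C2"] 1 show ?thesis
      by (force simp: C intro: hequiv.trans)
  qed
qed

text \<open>Writing \<open>c = x + (y - x) * m\<close>, translations by multiples of
  \<open>2 * (y - x)\<close> take the pair at \<open>c\<close> to \<open>x\<close> or to
  \<open>y\<close> according to the parity of \<open>m\<close>.\<close>

lemma dbl_two_valued:
  assumes "x \<in> set u" "y \<in> set u" "\<forall>c\<in>set C. y - x dvd c - x"
  shows "\<exists>s t. s + t = length C \<and> dbl C @ u \<approx> dbl (replicate s x @ replicate t y) @ u"
  using assms(3)
proof (induction C)
  case (Cons c C)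
  then obtain s t where st: "s + t = length C"
    "dbl C @ u \<approx> dbl (replicate s x @ replicate t y) @ u" by auto
  let ?r = "dbl (replicate s x @ replicate t y) @ u"
  have 1: "dbl (c # C) @ u \<approx> [c, c] @ ?r"
    using hequiv_context[OF st(2), of "[c, c]" "[]"] by simp
  obtain m where m: "c = x + (y - x) * m" using Cons.prems by (auto elim!: dvdE simp: algebra_simps)
  have xy: "x \<in> set ?r" "y \<in> set ?r" using assms by auto
  show ?case
  proof (cases "even m")
    case True
    then obtain j where j: "m = 2 * j" by (auto elim: evenE)
    have "[c, c] @ ?r \<approx> [x, x] @ ?r"
      using pair_translate[OF xy, of c "-j"] by (simp add: m j algebra_simps)
    then show ?thesis using 1 st(1)
      by (intro exI[of _ "Suc s"] exI[of _ t]) (auto intro: hequiv.trans)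
  next
    case False
    then obtain j where j: "m = 2 * j + 1" by (auto elim: oddE)
    have "[c, c] @ ?r \<approx> [y, y] @ ?r"
      using pair_translate[OF xy, of c "-j"] by (simp add: m j algebra_simps)
    also have "\<dots> \<approx> dbl (replicate s x @ replicate (Suc t) y) @ u"
      using hequiv_context[OF dbl_perm, of "y # replicate s x @ replicate t y"
          "replicate s x @ replicate (Suc t) y" "[]" u] by simp
    finally show ?thesis using 1 st(1)
      by (intro exI[of _ s] exI[of _ "Suc t"]) (auto intro: hequiv.trans)
  qed
qed (auto intro: hequiv.refl)

text \<open>Setting the pair \<open>c\<close> aside with the last two entries makes \<open>c\<close>
  available as a centre of reflection too.\<close>

lemma paired_two_valued:
  assumes "{x, y} \<subseteq> {c, a, a + h}" "\<forall>c\<in>set C. y - x dvd c - x"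
  shows "\<exists>s t. s + t = length C \<and>
    paired h (c # C) a \<approx> paired h (c # replicate s x @ replicate t y) a"
proof -
  have swap: "paired h (c # B) a \<approx> dbl B @ [c, c, a, a + h]" for B
    using hequiv_context[OF hequiv.sym[OF pair_past_list], of "[]" c "dbl B" "[a, a + h]"]
    by (simp add: paired_def)
  obtain s t where "s + t = length C"
    "dbl C @ [c, c, a, a + h] \<approx> dbl (replicate s x @ replicate t y) @ [c, c, a, a + h]"
    using dbl_two_valued[of x "[c, c, a, a + h]" y C] assms by auto
  then show ?thesis
    using swap[of C] swap[of "replicate s x @ replicate t y"]
    by (blast intro: hequiv.trans hequiv.sym)
qed

section \<open>Arrival at the representatives\<close>

text \<open>Pairs of value \<open>x + g\<close> move to the far right, and the entry
  \<open>a = x\<close> extends the initial block to odd length.\<close>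

lemma paired_E_odd:
  assumes "0 \<le> x" "x < g"
  shows "\<exists>v\<in>E_set (s + t + 2) (2 * s + 1).
    paired (2 * n * g) (replicate s x @ replicate (t + 1) (x + g)) x \<approx> v"
proof -
  let ?v = "replicate (2 * s) x @ [x, x + 2 * n * g] @ dbl (replicate (t + 1) (x + g))"
  have "paired (2 * n * g) (replicate s x @ replicate (t + 1) (x + g)) x \<approx> ?v"
    using hequiv_context[OF dbl_past_list, of "replicate (2 * s) x" "replicate (t + 1) (x + g)"
        "[x, x + 2 * n * g]" "[]"] by (simp add: paired_def)
  moreover have "?v \<in> E_set (s + t + 2) (2 * s + 1)"
    unfolding E_set_def using assms
    by (auto intro!: exI[of _ x] exI[of _ "x + g"] exI[of _ n] simp flip: replicate_append_same)
  ultimately show ?thesis by blast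
qed

text \<open>Here the last entry is \<open>x + g\<close> and extends the final block. The entry
  before it equals \<open>x + 2 * (1 - n) * g\<close>, which explains the witness
  \<open>1 - n\<close>.\<close>

lemma paired_E_even:
  assumes "0 \<le> x" "x < g"
  shows "\<exists>v\<in>E_set (s + t + 2) (2 * s + 2).
    paired ((2 * n - 1) * g) (replicate (s + 1) x @ replicate t (x + g)) (x + g - (2 * n - 1) * g) \<approx> v"
proof -
  let ?a = "x + g - (2 * n - 1) * g"
  let ?v = "replicate (2 * (s + 1)) x @ [?a, x + g] @ dbl (replicate t (x + g))"
  have "paired ((2 * n - 1) * g) (replicate (s + 1) x @ replicate t (x + g)) ?a \<approx> ?v"
    using hequiv_context[OF dbl_past_list, of "replicate (2 * (s + 1)) x" "replicate t (x + g)"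
        "[?a, x + g]" "[]"] by (simp add: paired_def)
  moreover have "?v \<in> E_set (s + t + 2) (2 * s + 2)"
    unfolding E_set_def using assms
    by (auto intro!: exI[of _ x] exI[of _ "x + g"] exI[of _ "1 - n"] simp: algebra_simps Suc_diff_le)
  ultimately show ?thesis by blast
qed

lemma paired_D:
  assumes "0 \<le> x" "x < g"
  shows "\<exists>v\<in>D_set (t + 2). paired ((2 * n - 1) * g) (replicate (t + 1) (x + g)) x \<approx> v"
proof -
  let ?v = "[x, x + (2 * n - 1) * g] @ dbl (replicate (t + 1) (x + g))"
  have "paired ((2 * n - 1) * g) (replicate (t + 1) (x + g)) x \<approx> ?v"
    using dbl_past_list by (simp only: paired_def)
  moreover have "?v \<in> D_set (t + 2)"
    unfolding D_set_def using assms
    by (auto intro!: exI[of _ x] exI[of _ "x + g"] exI[of _ n])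
  ultimately show ?thesis by blast
qed

text \<open>One pair is moved to \<open>x\<close> or \<open>y\<close> and the last two entries are
  adjusted so that both values occur; the other pairs then collapse onto \<open>x\<close> and
  \<open>y\<close>. If \<open>h / g\<close> is even, this ends in an \<open>E_set\<close> of odd
  index. If it is odd, it ends in \<open>D_set\<close> when all pairs have value \<open>y\<close>,
  and in an \<open>E_set\<close> of even index otherwise.\<close>

lemma paired_normal_form:
  assumes g: "g > 0" "gcd (c - a) h = g" "\<forall>x\<in>set C. g dvd x - a" and k: "k = length C + 2"
  shows "\<exists>v\<in>D_set k \<union> (\<Union>p\<in>{1..2 * k - 2}. E_set k p). paired h (c # C) a \<approx> v"
proof -
  define x where "x = a mod g"
  define y where "y = x + g"
  have x: "0 \<le> x" "x < g" using g by (auto simp: x_def)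
  have ax: "g dvd a - x" by (simp add: x_def minus_mod_eq_mult_div)
  have gh: "g dvd h" using g(2) by auto
  have C: "\<forall>e\<in>set C. y - x dvd e - x"
  proof
    fix e assume "e \<in> set C"
    then have "g dvd (e - a) + (a - x)" using g(3) ax by (intro dvd_add) auto
    then show "y - x dvd e - x" by (simp add: y_def)
  qed
  have "g dvd c - a" using g(2) by auto
  then have "g dvd (c - a) + (a - x)" using ax by (rule dvd_add)
  then have cx: "g dvd c - x" by simp
  \<comment> \<open>The two targets for \<open>paired_move\<close>: a pair \<open>y\<close> with
    last entries \<open>x, x + h\<close>, or a pair \<open>x\<close> with last entries
    \<open>y - h, y\<close>.\<close>
  have gcd1: "gcd (y - x) h = g" using gh g by (simp add: y_def gcd_proj1_if_dvd_int)
  have "x - (y - h) = h - g" by (simp add: y_def)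
  then have gcd2: "gcd (x - (y - h)) h = g"
    using gh g by (simp only: gcd_diff2 gcd_proj1_if_dvd_int abs_of_pos)
  consider (even) "2 * g dvd h" | (odd_y) "\<not> 2 * g dvd h" "2 * g dvd y - c"
    | (odd_x) "\<not> 2 * g dvd h" "2 * g dvd x - c"
  proof -
    obtain m where m: "c - x = g * m" using cx by (auto elim: dvdE)
    \<comment> \<open>\<open>x\<close> and \<open>y\<close> differ by \<open>g\<close>, so between
      them they represent both residues modulo \<open>2 * g\<close> that \<open>c\<close> can
      have.\<close>
    have "2 * g dvd x - c \<or> 2 * g dvd y - c"
    proof (cases "even m")
      case True
      then obtain i where "m = 2 * i" by (auto elim: evenE)
      then have "x - c = 2 * g * (- i)" using m by (simp add: algebra_simps)
      then show ?thesis by (metis dvd_triv_left)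
    next
      case False
      then obtain i where "m = 2 * i + 1" by (auto elim: oddE)
      then have "y - c = 2 * g * (- i)" using m by (simp add: y_def algebra_simps)
      then show ?thesis by (metis dvd_triv_left)
    qed
    then show thesis using that by blast
  qed
  then show ?thesis
  proof cases
    case even
    then obtain n where "h = 2 * g * n" by (elim dvdE)
    then have n: "h = 2 * n * g" by simp
    have "g dvd g - (c - x)" using dvd_refl cx by (rule dvd_diff)
    then have "g dvd y - c" by (simp add: y_def algebra_simps)
    then have "paired h (c # C) a \<approx> paired h (y # C) x"
      using even g gcd1 by (intro paired_move[where g = g]) auto
    moreover obtain s t where st: "s + t = length C"
      "paired h (y # C) x \<approx> paired h (y # replicate s x @ replicate t y) x"
      using paired_two_valued[of x y y x h C] C by auto
    moreover have "paired h (y # replicate s x @ replicate t y) x \<approx>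
        paired h (replicate s x @ replicate (t + 1) y) x"
      by (rule paired_perm) simp
    moreover obtain v where "v \<in> E_set k (2 * s + 1)"
      "paired h (replicate s x @ replicate (t + 1) y) x \<approx> v"
      using paired_E_odd[OF x, of s t n] st(1) k by (auto simp: n y_def)
    moreover have "2 * s + 1 \<in> {1..2 * k - 2}" using st(1) k by auto
    ultimately show ?thesis by (blast intro: hequiv.trans)
  next
    case odd_y
    obtain q where q: "h = g * q" using gh by (auto elim: dvdE)
    have "odd q" using odd_y by (auto simp: q elim!: evenE)
    then obtain i where "q = 2 * i + 1" by (auto elim: oddE)
    then have n: "h = (2 * (i + 1) - 1) * g" by (simp add: q algebra_simps)
    have "paired h (c # C) a \<approx> paired h (y # C) x"
      using odd_y g gcd1 by (intro paired_move[where g = g]) auto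
    moreover obtain s t where st: "s + t = length C"
      "paired h (y # C) x \<approx> paired h (y # replicate s x @ replicate t y) x"
      using paired_two_valued[of x y y x h C] C by auto
    ultimately have 1: "paired h (c # C) a \<approx> paired h (y # replicate s x @ replicate t y) x"
      by (blast intro: hequiv.trans)
    show ?thesis
    proof (cases s)
      case 0
      then show ?thesis using 1 paired_D[OF x, of t "i + 1"] st(1) k
        by (auto simp: n y_def intro: hequiv.trans)
    next
      case (Suc s')
      let ?C = "replicate s' x @ replicate (t + 1) y"
      \<comment> \<open>A pair \<open>x\<close> next to \<open>a = x\<close> has gcd
        \<open>\<bar>h\<bar>\<close>, which may exceed \<open>g\<close>. Reflecting it in
        \<open>y\<close> first puts it at distance \<open>2 * g\<close> from \<open>a\<close>, where
        oddness of \<open>q\<close> gives gcd \<open>g\<close>, so \<open>paired_move\<close>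
        applies.\<close>
      have "gcd (2 * g) h = g * gcd 2 q" 
        using gcd_mult_distrib_int[of g 2 q] g by (simp add: q mult.commute[of 2])
      also have "gcd 2 q = 1" using \<open>odd q\<close> by (simp add: coprime_iff_gcd_eq_1 [symmetric])
      finally have g2: "gcd (2 * g) h = g" by simp
      note 1
      also have "paired h (y # replicate s x @ replicate t y) x \<approx> paired h (x # ?C) x"
        by (rule paired_perm) (simp add: Suc)
      also have "\<dots> \<approx> paired h ((2 * y - x) # ?C) x"
        by (rule paired_reflect) simp
      also have "\<dots> \<approx> paired h (x # ?C) (y - h)"
        using gcd2 g2 by (intro paired_move[where g = g]) (auto simp: y_def)
      finally have "paired h (c # C) a \<approx> paired h (replicate (s' + 1) x @ replicate (t + 1) y) (y - h)"
        by simp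
      moreover obtain v where "v \<in> E_set k (2 * s' + 2)"
        "paired h (replicate (s' + 1) x @ replicate (t + 1) y) (y - h) \<approx> v"
        using paired_E_even[OF x, of s' "t + 1" "i + 1"] st(1) k Suc unfolding n y_def by auto
      moreover have "2 * s' + 2 \<in> {1..2 * k - 2}" using st(1) k Suc by auto
      ultimately show ?thesis by (blast intro: hequiv.trans)
    qed
  next
    case odd_x
    obtain q where q: "h = g * q" using gh by (auto elim: dvdE)
    have "odd q" using odd_x by (auto simp: q elim!: evenE)
    then obtain i where "q = 2 * i + 1" by (auto elim: oddE)
    then have n: "h = (2 * (i + 1) - 1) * g" by (simp add: q algebra_simps)
    have "paired h (c # C) a \<approx> paired h (x # C) (y - h)"
      using odd_x g gcd2 by (intro paired_move[where g = g]) auto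
    moreover obtain s t where st: "s + t = length C"
      "paired h (x # C) (y - h) \<approx> paired h (x # replicate s x @ replicate t y) (y - h)"
      using paired_two_valued[of x y x "y - h" h C] C by auto
    moreover obtain v where "v \<in> E_set k (2 * s + 2)"
      "paired h (x # replicate s x @ replicate t y) (y - h) \<approx> v"
      using paired_E_even[OF x, of s t "i + 1"] st(1) k unfolding n y_def by auto
    moreover have "2 * s + 2 \<in> {1..2 * k - 2}" using st(1) k by auto
    ultimately show ?thesis by (blast intro: hequiv.trans)
  qed
qed

lemma hequiv_normal_form:
  assumes "k \<ge> 2" "length v = 2 * k"
  shows "\<exists>s\<in>const_vecs k \<union> D_set k \<union> (\<Union>p\<in>{1..2 * k - 2}. E_set k p). v \<approx> s"
proof -
  have "length v = 2 * (k - 1) + 2" using assms by simp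
  then obtain C h a where C: "length C = k - 1" "v \<approx> paired h C a"
    using hequiv_paired by blast
  show ?thesis
  proof (cases "\<exists>c\<in>set C. gcd (c - a) h > 0")
    case True
    then obtain c C1 C2 where c: "gcd (c - a) h > 0" "C = C1 @ c # C2"
      using split_list by metis
    have "paired h C a \<approx> paired h (c # C1 @ C2) a" by (rule paired_perm) (simp add: c)
    moreover obtain c' C' a' where *: "length C' = length (C1 @ C2)"
      "paired h (c # C1 @ C2) a \<approx> paired h (c' # C') a'"
      "gcd (c' - a') h > 0" "\<forall>x\<in>set C'. gcd (c' - a') h dvd x - a'"
      using paired_reduce[OF c(1), of "C1 @ C2"] by blast
    ultimately have "v \<approx> paired h (c' # C') a'"
      using C(2) by (blast intro: hequiv.trans)
    moreover have "k = length C' + 2" using * C c assms by auto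
    then obtain s where "s \<in> D_set k \<union> (\<Union>p\<in>{1..2 * k - 2}. E_set k p)"
      "paired h (c' # C') a' \<approx> s"
      using paired_normal_form[OF *(3) HOL.refl *(4)] by blast
    ultimately show ?thesis using hequiv.trans by blast
  next
    case False
    then have "\<forall>c\<in>set C. gcd (c - a) h = 0" by (metis gcd_ge_0_int order_le_less)
    then have eq: "\<forall>c\<in>set C. c = a \<and> h = 0" by simp
    \<comment> \<open>Since \<open>k \<ge> 2\<close> there is at least one pair, and its vanishing
      gcd forces \<open>h = 0\<close>.\<close>
    moreover have "C \<noteq> []" using C assms by auto
    ultimately have "h = 0" by (cases C) auto
    moreover have "C = replicate (k - 1) a" using eq C(1) by (simp add: replicate_eqI)
    ultimately have "paired h C a = replicate (2 * (k - 1) + 2) a"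
      unfolding replicate_add by (simp add: paired_def numeral_2_eq_2)
    moreover have "2 * (k - 1) + 2 = 2 * k" using assms by simp
    ultimately have "paired h C a = replicate (2 * k) a" by (simp only:)
    then have "paired h C a \<in> const_vecs k" by (auto simp: const_vecs_def)
    then show ?thesis using C(2) by blast
  qed
qed

theorem proposition5p4:
  fixes k :: nat
  assumes "k \<ge> 2"
  shows "complete_reps (int_vecs (2 * k)) (hurwitz_rel (2 * k))
           (const_vecs k \<union> D_set k \<union> (\<Union>p\<in>{1..2 * k - 2}. E_set k p))
         \<and> const_vecs k \<inter> D_set k = {}
         \<and> (\<forall>p\<in>{1..2 * k - 2}. const_vecs k \<inter> E_set k p = {} \<and> D_set k \<inter> E_set k p = {})
         \<and> disjoint_family_on (E_set k) {1..2 * k - 2}"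
proof -
  let ?S = "const_vecs k \<union> D_set k \<union> (\<Union>p\<in>{1..2 * k - 2}. E_set k p)"
  have const_D: "\<not> s \<approx> t" if "s \<in> const_vecs k" "t \<in> D_set k" for s t
    using that const_vecs_no_profile D_set_profile[OF assms that(2)] by metis
  have const_E: "\<not> s \<approx> t" if "s \<in> const_vecs k" "p \<in> {1..2 * k - 2}" "t \<in> E_set k p" for s t p
    using that const_vecs_no_profile E_set_profile[OF that(2,3)] by metis
  note D_E = D_E_set_not_hequiv[OF assms]
  have "?S \<subseteq> int_vecs (2 * k)"
    using assms by (auto simp: int_vecs_def const_vecs_def D_set_def E_set_def)
  moreover have "s = t" if "s \<in> ?S" "t \<in> ?S" "s \<approx> t" for s t
    using that const_vecs_unique D_set_unique[OF assms] E_set_unique(2) const_D const_E D_E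
      hequiv.sym[OF that(3)] by (elim UnE UN_E) blast+
  ultimately have "complete_reps (int_vecs (2 * k)) (hurwitz_rel (2 * k)) ?S"
    using hequiv_normal_form[OF assms] by (simp only: complete_reps_hurwitz_iff) blast
  moreover have "const_vecs k \<inter> D_set k = {}"
    using const_D hequiv.refl by blast
  moreover have "\<forall>p\<in>{1..2 * k - 2}. const_vecs k \<inter> E_set k p = {} \<and> D_set k \<inter> E_set k p = {}"
    using const_E D_E hequiv.refl by blast
  moreover have "disjoint_family_on (E_set k) {1..2 * k - 2}"
    using E_set_unique(1) hequiv.refl by (fastforce simp: disjoint_family_on_def)
  ultimately show ?thesis by blast
qed

end
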